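(* Let $u,v\in\mathbb{N}$ and let $A$ be a $u\times v$ matrix with entries from $\mathbb{Z}[i]$ which is image partition regular over $\mathbb{Z}[i]$. If $C$ is thick in $\mathbb{Z}[i]$, then $W=\{\vec{z}\in(\mathbb{Z}[i]\setminus\{0\})^{v}:A\vec{z}\in C^{u}\}$ is thick in $(\mathbb{Z}[i])^{v}$.
   Context: $\mathbb{Z}[i]$ is the ring of Gaussian integers; $C^u$ is the set of vectors all of whose $u$ entries lie in $C$. A $u\times v$ matrix $A$ with entries in $\mathbb{Z}[i]$ is image partition regular over $\mathbb{Z}[i]$ if for every $k\in\mathbb{N}$ and every partition $\mathbb{Z}[i]\setminus\{0\}=\bigcup_{j=1}^k D_j$ there are $j$ and $\vec{x}\in(\mathbb{Z}[i]\setminus\{0\})^v$ with $A\vec{x}\in D_j^u$. In a commutative semigroup $(S,+)$, $B\subseteq S$ is thick if for every finite nonempty $F\subseteq S$ there is $x\in S$ with $F+x\subseteq B$ (equivalently, $B$ meets every syndetic set, i.e. every $B'$ with $S=\bigcup_{t\in G}(-t+B')$ for some finite nonempty $G\subseteq S$). *)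

theory Defs
  imports "HOL-Analysis.Analysis" "HOL-Library.Disjoint_Sets"
begin

definition gaussian_integers :: "complex set" where
  "gaussian_integers = {of_int a + \<i> * of_int b | a b. True}"

lemma gaussian_integers_add:
  "x \<in> gaussian_integers \<Longrightarrow> y \<in> gaussian_integers \<Longrightarrow> x + y \<in> gaussian_integers"
  unfolding gaussian_integers_def
proof safe
  fix a b c d :: int
  have "of_int a + \<i> * of_int b + (of_int c + \<i> * of_int d)
      = of_int (a + c) + \<i> * (of_int (b + d) :: complex)"
    by (simp add: algebra_simps)
  then show "\<exists>p q. of_int a + \<i> * of_int b + (of_int c + \<i> * of_int d)
      = of_int p + \<i> * (of_int q :: complex) \<and> True"
    by blast
qed

definition vectors_over :: "'a set \<Rightarrow> ('a ^ 'n::finite) set" where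
  "vectors_over C = {x. \<forall>i. x $ i \<in> C}"

lemma vectors_over_gaussian_integers_add:
  "x \<in> vectors_over gaussian_integers \<Longrightarrow> y \<in> vectors_over gaussian_integers
    \<Longrightarrow> x + y \<in> vectors_over gaussian_integers"
  by (simp add: vectors_over_def gaussian_integers_add)

text \<open>The set \<open>S\<close> is the carrier of a commutative semigroup under the ambient addition; it is
  used below for the two carriers shown above to be closed under addition.\<close>

definition thick_in :: "'a::ab_semigroup_add set \<Rightarrow> 'a set \<Rightarrow> bool" where
  "thick_in S B \<longleftrightarrow> B \<subseteq> S \<and>
     (\<forall>F. finite F \<and> F \<noteq> {} \<and> F \<subseteq> S \<longrightarrow> (\<exists>x\<in>S. (\<lambda>y. y + x) ` F \<subseteq> B))"

definition image_partition_regular :: "complex ^ 'v::finite ^ 'u::finite \<Rightarrow> bool" where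
  "image_partition_regular A \<longleftrightarrow>
     (\<forall>k\<ge>1. \<forall>D :: nat \<Rightarrow> complex set.
        disjoint_family_on D {1..k} \<and> (\<Union>j\<in>{1..k}. D j) = gaussian_integers - {0} \<longrightarrow>
        (\<exists>j\<in>{1..k}. \<exists>x \<in> vectors_over (gaussian_integers - {0}). A *v x \<in> vectors_over (D j)))"

end

theory Submission
  imports Defs "HOL-Computational_Algebra.Primes"
begin

text \<open>
  Rado's colouring argument shows that the rows of \<open>A\<close> carry a level function for which every
  level \<open>n\<close> admits a vector \<open>z\<close> with \<open>A z\<close> equal to a fixed positive integer \<open>d\<close> on level \<open>n\<close>
  and to \<open>0\<close> on all higher levels: colour \<open>x \<noteq> 0\<close> by its last nonzero digit in base \<open>p\<close>, for a
  large prime \<open>p\<close>, and let the level of a row be the \<open>p\<close>-adic valuation of the corresponding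
  entry of a monochromatic image. If \<open>z\<close> did not exist, a linear relation between the rows
  would give a divisibility by \<open>p\<close> that is impossible for large \<open>p\<close>.

  Given such levels, a thick set absorbs the rows level by level, from the top downwards: adding
  a multiple of \<open>z\<close> moves level \<open>n\<close> by multiples of \<open>d\<close>, leaves the higher levels alone, and the
  disturbance of the lower levels is just a finite set of offsets, to be absorbed later. The
  entries of the solution are made nonzero by absorbing also the translates by small multiples
  of \<open>(1, \<dots>, 1)\<close>.
\<close>

section \<open>Gaussian integers\<close>

lemma gaussian_integers_iff: "x \<in> gaussian_integers \<longleftrightarrow> Re x \<in> \<int> \<and> Im x \<in> \<int>"
proof
  assume "Re x \<in> \<int> \<and> Im x \<in> \<int>"
  then obtain a b where "Re x = of_int a" "Im x = of_int b"
    by (auto elim!: Ints_cases)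
  then have "x = of_int a + \<i> * of_int b"
    by (simp add: complex_eq_iff)
  then show "x \<in> gaussian_integers"
    by (auto simp: gaussian_integers_def)
qed (auto simp: gaussian_integers_def)

lemma gaussian_integers_of_nat [simp]: "of_nat n \<in> gaussian_integers"
  and gaussian_integers_0 [simp]: "0 \<in> gaussian_integers"
  and gaussian_integers_1 [simp]: "1 \<in> gaussian_integers"
  and gaussian_integers_cnj: "x \<in> gaussian_integers \<Longrightarrow> cnj x \<in> gaussian_integers"
  and gaussian_integers_diff: "x \<in> gaussian_integers \<Longrightarrow> y \<in> gaussian_integers \<Longrightarrow> x - y \<in> gaussian_integers"
  and gaussian_integers_mult: "x \<in> gaussian_integers \<Longrightarrow> y \<in> gaussian_integers \<Longrightarrow> x * y \<in> gaussian_integers"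
  by (auto simp: gaussian_integers_iff)

lemma gaussian_integers_sum:
  "(\<And>i. i \<in> I \<Longrightarrow> f i \<in> gaussian_integers) \<Longrightarrow> sum f I \<in> gaussian_integers"
  by (induction I rule: infinite_finite_induct) (auto intro: gaussian_integers_add)

text \<open>The conjugate trades a Gaussian factor for a positive natural number: once to normalise
  a solution, once to reduce divisibility to ordinary integers.\<close>

lemma gaussian_integers_mult_cnj:
  assumes "x \<in> gaussian_integers" "x \<noteq> 0"
  obtains n :: nat where "n > 0" "x * cnj x = of_nat n"
proof -
  from assms(1) obtain a b where ab: "Re x = of_int a" "Im x = of_int b"
    by (auto simp: gaussian_integers_iff elim!: Ints_cases)
  have "a\<^sup>2 + b\<^sup>2 > 0"
    using assms(2) ab by (auto simp: complex_eq_iff sum_power2_gt_zero_iff)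
  moreover have "x * cnj x = of_int (a\<^sup>2 + b\<^sup>2)"
    using ab by (simp add: complex_eq_iff power2_eq_square)
  ultimately show ?thesis
    using that[of "nat (a\<^sup>2 + b\<^sup>2)"] by (metis of_int_of_nat_eq int_nat_eq less_imp_le zero_less_nat_eq)
qed

lemma gaussian_integers_norm_ge_1:
  assumes "x \<in> gaussian_integers" "x \<noteq> 0"
  shows "norm x \<ge> 1"
proof -
  have "\<bar>Re x\<bar> \<ge> 1 \<or> \<bar>Im x\<bar> \<ge> 1"
    using assms by (auto simp: gaussian_integers_iff complex_eq_iff intro: Ints_nonzero_abs_ge1)
  then show ?thesis
    using abs_Re_le_cmod[of x] abs_Im_le_cmod[of x] by linarith
qed

section \<open>Residues modulo n and last nonzero digits in base p\<close>

definition gaussian_digits :: "nat \<Rightarrow> complex set" where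
  "gaussian_digits n = (\<lambda>(a, b). of_nat a + \<i> * of_nat b) ` ({..<n} \<times> {..<n})"

lemma finite_gaussian_digits [simp]: "finite (gaussian_digits n)"
  by (simp add: gaussian_digits_def)

lemma gaussian_digits_subset: "gaussian_digits n \<subseteq> gaussian_integers"
  by (auto simp: gaussian_digits_def gaussian_integers_iff)

lemma gaussian_integers_divmod:
  assumes "x \<in> gaussian_integers" "n > 0"
  obtains r g where "r \<in> gaussian_digits n" "g \<in> gaussian_integers" "x = r + of_nat n * g"
proof -
  from assms(1) obtain a b where ab: "Re x = of_int a" "Im x = of_int b"
    by (auto simp: gaussian_integers_iff elim!: Ints_cases)
  define r :: complex where "r = of_nat (nat (a mod n)) + \<i> * of_nat (nat (b mod n))"
  define g :: complex where "g = of_int (a div n) + \<i> * of_int (b div n)"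
  have split: "real_of_int c = real (nat (c mod n)) + real n * real_of_int (c div n)" for c
  proof -
    have "c = int (nat (c mod n)) + int n * (c div n)"
      using assms(2) by simp
    then show ?thesis
      by (metis of_int_add of_int_mult of_int_of_nat_eq)
  qed
  have "r \<in> gaussian_digits n"
    unfolding r_def gaussian_digits_def using assms(2)
    by (intro image_eqI[where x = "(nat (a mod n), nat (b mod n))"]) (auto simp: nat_less_iff)
  moreover have "g \<in> gaussian_integers"
    by (auto simp: g_def gaussian_integers_def)
  moreover have "x = r + of_nat n * g"
    using ab split[of a] split[of b] by (simp add: complex_eq_iff r_def g_def)
  ultimately show ?thesis
    by (rule that)
qed

text \<open>Splitting off a zero digit divides the norm by \<open>p\<close>, hence at least halves
  it, while nonzero Gaussian integers have norm at least 1. So a nonzero digit appears after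
  finitely many divisions; the induction runs on a bound \<open>2 ^ N\<close> for the norm.\<close>

lemma gaussian_integers_last_digit:
  assumes "x \<in> gaussian_integers" "x \<noteq> 0" "p \<ge> 2"
  shows "\<exists>n. \<exists>r \<in> gaussian_digits p - {0}. \<exists>g \<in> gaussian_integers.
           x = of_nat p ^ n * (r + of_nat p * g)"
proof -
  obtain N where "norm x < 2 ^ N"
    using real_arch_pow[of 2 "norm x"] by auto
  with assms(1,2) show ?thesis
  proof (induction N arbitrary: x)
    case 0
    then show ?case
      using gaussian_integers_norm_ge_1[of x] by simp
  next
    case (Suc N)
    obtain r g where rg: "r \<in> gaussian_digits p" "g \<in> gaussian_integers" "x = r + of_nat p * g"
      using gaussian_integers_divmod[of x p] Suc.prems(1) assms(3) by auto
    show ?case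
    proof (cases "r = 0")
      case False
      then show ?thesis
        using rg by (intro exI[of _ 0]) auto
    next
      case True
      then have "g \<noteq> 0"
        using rg Suc.prems by auto
      have "2 * norm g \<le> real p * norm g"
        using assms(3) by (intro mult_right_mono) auto
      also have "\<dots> = norm x"
        using rg True by (simp add: norm_mult)
      finally have "norm g < 2 ^ N"
        using Suc.prems by simp
      then obtain n s h where "s \<in> gaussian_digits p - {0}" "h \<in> gaussian_integers"
          "g = of_nat p ^ n * (s + of_nat p * h)"
        using Suc.IH[of g] rg \<open>g \<noteq> 0\<close> by blast
      then show ?thesis
        using rg True by (intro exI[of _ "Suc n"]) (auto simp: mult.assoc)
    qed
  qed
qed

text \<open>A rational prime may split in the Gaussian integers, so primality is applied to
  coordinates only. As the cofactor \<open>n\<close> is a natural number, the equation separates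
  into real and imaginary parts; in each, \<open>p\<close> divides a digit times \<open>n\<close>
  but not \<open>n\<close>, and a digit below \<open>p\<close> divisible by \<open>p\<close> is
  0.\<close>

lemma prime_not_dvd_gaussian_digit_mult:
  assumes "prime p" "0 < n" "n < p" "r \<in> gaussian_digits p" "h \<in> gaussian_integers"
    and eq: "r * of_nat n = of_nat p * h"
  shows "r = 0"
proof -
  from assms(4) obtain a b where ab: "a < p" "b < p" "r = of_nat a + \<i> * of_nat b"
    by (auto simp: gaussian_digits_def)
  from assms(5) obtain c d where cd: "h = of_int c + \<i> * of_int d"
    by (auto simp: gaussian_integers_def)
  have zero: "e = 0" if "e < p" "real e * real n = real p * of_int f" for e :: nat and f
  proof -
    have "of_int (int e * int n) = (of_int (int p * f) :: real)"
      using that by simp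
    then have "int (e * n) = int p * f"
      using of_int_eq_iff by fastforce
    then have "int p dvd int (e * n)"
      by simp
    then have "p dvd e * n"
      by (simp only: int_dvd_int_iff)
    then show ?thesis
      using assms(1-3) that(1) by (auto simp: prime_dvd_mult_iff dest: dvd_imp_le)
  qed
  have "real a * real n = real p * of_int c" "real b * real n = real p * of_int d"
    using eq ab cd by (simp_all add: complex_eq_iff)
  then show ?thesis
    using zero[of a c] zero[of b d] ab by simp
qed

section \<open>The Fredholm alternative over a subring\<close>

text \<open>Fraction-free elimination of one column at a time, with pivot \<open>M r c\<close>.\<close>

lemma fredholm_alternative_subring:
  fixes G :: "'a :: idom set" and M :: "'r \<Rightarrow> 'c \<Rightarrow> 'a"
  assumes G0: "0 \<in> G" and G1: "1 \<in> G"
    and Gdiff: "\<And>x y. x \<in> G \<Longrightarrow> y \<in> G \<Longrightarrow> x - y \<in> G"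
    and Gmult: "\<And>x y. x \<in> G \<Longrightarrow> y \<in> G \<Longrightarrow> x * y \<in> G"
    and "finite S" and fin: "finite R"
    and "\<And>i j. i \<in> R \<Longrightarrow> j \<in> S \<Longrightarrow> M i j \<in> G" and "\<And>i. i \<in> R \<Longrightarrow> b i \<in> G"
  shows "(\<exists>x d. range x \<subseteq> G \<and> d \<in> G - {0} \<and> (\<forall>i\<in>R. (\<Sum>j\<in>S. M i j * x j) = d * b i)) \<or>
         (\<exists>\<phi>. range \<phi> \<subseteq> G \<and> (\<forall>j\<in>S. (\<Sum>i\<in>R. \<phi> i * M i j) = 0) \<and> (\<Sum>i\<in>R. \<phi> i * b i) \<noteq> 0)"
  using \<open>finite S\<close> assms(7,8)
proof (induction S arbitrary: M b rule: finite_induct)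
  case empty
  show ?case
  proof (cases "\<forall>i\<in>R. b i = 0")
    case True
    then show ?thesis
      using G0 G1 by (intro disjI1 exI[of _ "\<lambda>_. 0"] exI[of _ 1]) auto
  next
    case False
    then obtain k where "k \<in> R" "b k \<noteq> 0"
      by blast
    \<comment> \<open>With no columns left, every coefficient vector is a relation; the indicator of
      one row with \<open>b k \<noteq> 0\<close> detects \<open>b\<close>.\<close>
    then have "(\<Sum>i\<in>R. of_bool (i = k) * b i) \<noteq> 0"
      using fin by (simp add: of_bool_def if_distrib[of "\<lambda>x. x * _"] cong: if_cong)
    then show ?thesis
      using G0 G1 by (intro disjI2 exI[of _ "\<lambda>i. of_bool (i = k)"]) auto
  qed
next
  case (insert c S)
  have Gsum: "sum f T \<in> G" if "\<And>t. t \<in> T \<Longrightarrow> f t \<in> G" for f :: "'t \<Rightarrow> 'a" and T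
  proof -
    have "x + y \<in> G" if "x \<in> G" "y \<in> G" for x y
      using Gdiff[of x "0 - y"] Gdiff[of 0 y] G0 that by simp
    then show ?thesis
      using that G0 by (induction T rule: infinite_finite_induct) auto
  qed
  have sumS: "(\<Sum>j\<in>insert c S. f j) = f c + (\<Sum>j\<in>S. f j)" for f :: "'c \<Rightarrow> 'a"
    using insert.hyps by simp
  show ?case
  proof (cases "\<forall>i\<in>R. M i c = 0")
    case True
    from insert.IH[of M b] insert.prems show ?thesis
      unfolding sumS using True by auto
  next
    case False
    then obtain r where r: "r \<in> R" "M r c \<noteq> 0"
      by blast
    \<comment> \<open>Cross-multiplication with the pivot clears column \<open>c\<close> and turns
      row \<open>r\<close> into zero without division, so all entries stay in
      \<open>G\<close>.\<close>
    define M' where "M' = (\<lambda>i j. M r c * M i j - M i c * M r j)"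
    define b' where "b' = (\<lambda>i. M r c * b i - M i c * b r)"
    have "M' i j \<in> G" if "i \<in> R" "j \<in> S" for i j
      using that r insert.prems by (auto simp: M'_def intro!: Gdiff Gmult)
    moreover have "b' i \<in> G" if "i \<in> R" for i
      using that r insert.prems by (auto simp: b'_def intro!: Gdiff Gmult)
    ultimately consider
        (sol) x d where "range x \<subseteq> G" "d \<in> G - {0}" "\<forall>i\<in>R. (\<Sum>j\<in>S. M' i j * x j) = d * b' i"
      | (rel) \<phi> where "range \<phi> \<subseteq> G" "\<forall>j\<in>S. (\<Sum>i\<in>R. \<phi> i * M' i j) = 0" "(\<Sum>i\<in>R. \<phi> i * b' i) \<noteq> 0"
      using insert.IH[of M' b'] by blast
    then show ?thesis
    proof cases
      case sol
      \<comment> \<open>Back substitution: scaling the other unknowns by \<open>M r c\<close> lets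
        the equation of row \<open>r\<close> determine \<open>y c\<close> without division. The
        factor of \<open>b\<close> becomes \<open>d * M r c\<close>, nonzero in a domain.\<close>
      define y where "y = (\<lambda>j. if j = c then d * b r - (\<Sum>j\<in>S. M r j * x j)
                               else M r c * x j)"
      have "range y \<subseteq> G"
        using sol r insert.prems by (auto simp: y_def intro!: Gdiff Gmult Gsum)
      moreover have "d * M r c \<in> G - {0}"
        using sol r insert.prems by (auto intro: Gmult)
      moreover have "(\<Sum>j\<in>insert c S. M i j * y j) = d * M r c * b i" if "i \<in> R" for i
      proof -
        have "(\<Sum>j\<in>S. M i j * y j) = (\<Sum>j\<in>S. M r c * (M i j * x j))"
          using insert.hyps by (intro sum.cong) (auto simp: y_def)
        also have "\<dots> = (\<Sum>j\<in>S. M' i j * x j) + M i c * (\<Sum>j\<in>S. M r j * x j)"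
          by (simp add: M'_def sum_distrib_left algebra_simps flip: sum.distrib)
        also have "\<dots> = d * b' i + M i c * (\<Sum>j\<in>S. M r j * x j)"
          using sol that by simp
        finally show ?thesis
          unfolding sumS by (simp add: y_def b'_def algebra_simps)
      qed
      ultimately show ?thesis
        by (intro disjI1) blast
    next
      case rel
      \<comment> \<open>Transposed row operations: each row \<open>k\<close> lost
        \<open>M k c\<close> times row \<open>r\<close>, so the coefficient of row \<open>r\<close>
        is lowered by the sum of all \<open>\<phi> k * M k c\<close>.\<close>
      define \<psi> where "\<psi> = (\<lambda>i. M r c * \<phi> i - of_bool (i = r) * (\<Sum>k\<in>R. \<phi> k * M k c))"
      have \<psi>: "(\<Sum>i\<in>R. \<psi> i * f i) = (\<Sum>i\<in>R. \<phi> i * (M r c * f i - M i c * f r))" for f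
      proof -
        have "(\<Sum>i\<in>R. \<psi> i * f i) = (\<Sum>i\<in>R. M r c * \<phi> i * f i)
            - (\<Sum>i\<in>R. of_bool (i = r) * ((\<Sum>k\<in>R. \<phi> k * M k c) * f i))"
          by (simp add: \<psi>_def left_diff_distrib sum_subtractf mult.assoc)
        also have "(\<Sum>i\<in>R. of_bool (i = r) * ((\<Sum>k\<in>R. \<phi> k * M k c) * f i))
            = (\<Sum>k\<in>R. \<phi> k * M k c) * f r"
          using fin r by (simp add: of_bool_def if_distrib[of "\<lambda>x. x * _"] cong: if_cong)
        finally show ?thesis
          by (simp add: sum_distrib_left right_diff_distrib sum_subtractf mult_ac)
      qed
      have "range \<psi> \<subseteq> G"
        using rel r insert.prems G0 G1 by (auto simp: \<psi>_def intro!: Gdiff Gmult Gsum)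
      moreover have "\<forall>j\<in>insert c S. (\<Sum>i\<in>R. \<psi> i * M i j) = 0"
        using rel by (auto simp: \<psi> M'_def mult.commute)
      moreover have "(\<Sum>i\<in>R. \<psi> i * b i) \<noteq> 0"
        using rel by (simp add: \<psi> b'_def)
      ultimately show ?thesis
        by (intro disjI2) blast
    qed
  qed
qed

section \<open>Rado's colouring argument\<close>

text \<open>Passes from partitions indexed by \<open>{1..k}\<close> to colourings with finite range:
  the colours are enumerated and each class is a fibre of \<open>f\<close>. The classes omit 0, so
  the entries of the image are nonzero.\<close>

lemma image_partition_regular_colouring:
  fixes A :: "complex ^ 'v::finite ^ 'u::finite"
  assumes "image_partition_regular A" and fin: "finite (f ` (gaussian_integers - {0}))"
  obtains x c where "x \<in> vectors_over (gaussian_integers - {0})"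
    "\<And>i. (A *v x) $ i \<in> gaussian_integers - {0}" "\<And>i. f ((A *v x) $ i) = c"
proof -
  let ?G = "gaussian_integers - {0}"
  define k where "k = card (f ` ?G)"
  obtain h where h: "bij_betw h {1..k} (f ` ?G)"
    using fin ex_bij_betw_nat_finite_1 unfolding k_def by blast
  define D where "D j = {x \<in> ?G. f x = h j}" for j
  have "1 \<in> ?G"
    by simp
  then have "k \<ge> 1"
    using fin unfolding k_def by (metis One_nat_def Suc_leI card_gt_0_iff empty_iff image_eqI)
  moreover have "disjoint_family_on D {1..k}"
    using bij_betw_imp_inj_on[OF h] unfolding disjoint_family_on_def D_def
    by (fastforce dest: inj_onD)
  moreover have "(\<Union>j\<in>{1..k}. D j) = ?G"
    using bij_betw_imp_surj_on[OF h] unfolding D_def by blast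
  ultimately obtain j x where "x \<in> vectors_over ?G" "A *v x \<in> vectors_over (D j)"
    using assms(1) unfolding image_partition_regular_def by blast
  then show ?thesis
    using that[of x "h j"] by (auto simp: vectors_over_def D_def)
qed

text \<open>The sets \<open>I\<close> and \<open>K\<close> stand for the rows on a given level and on all higher levels.\<close>

definition solves_level :: "complex ^ 'v::finite ^ 'u::finite \<Rightarrow> 'u set \<Rightarrow> 'u set \<Rightarrow> bool" where
  "solves_level A I K \<longleftrightarrow> (\<exists>z \<in> vectors_over gaussian_integers. \<exists>d::nat. d > 0 \<and>
     (\<forall>i\<in>I. (A *v z) $ i = of_nat d) \<and> (\<forall>i\<in>K. (A *v z) $ i = 0))"

text \<open>The threshold \<open>N\<close> depends on the matrix and the two row sets only, so the
  prime can be chosen before any colouring. If no multiple of the system for \<open>z\<close> is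
  soluble, some relation between the rows has coefficient sum \<open>s \<noteq> 0\<close> on
  \<open>I\<close>; applied to \<open>A *v x\<close> it makes \<open>p\<close> divide
  \<open>r * s\<close>, which fails once \<open>p\<close> exceeds the squared modulus of
  \<open>s\<close>.\<close>

lemma solves_level_large_prime:
  fixes A :: "complex ^ 'v::finite ^ 'u::finite"
  assumes A: "\<forall>i j. A $ i $ j \<in> gaussian_integers" and disj: "I \<inter> K = {}"
  shows "\<exists>N. \<forall>p r q x. prime p \<longrightarrow> N < p \<longrightarrow> r \<in> gaussian_digits p - {0} \<longrightarrow> q \<noteq> 0 \<longrightarrow>
    (\<forall>i\<in>I. \<exists>g\<in>gaussian_integers. (A *v x) $ i = q * (r + of_nat p * g)) \<longrightarrow>
    (\<forall>i\<in>K. \<exists>g\<in>gaussian_integers. (A *v x) $ i = q * (of_nat p * g)) \<longrightarrow>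
    solves_level A I K"
proof -
  let ?G = gaussian_integers
  have "(\<exists>x d. range x \<subseteq> ?G \<and> d \<in> ?G - {0} \<and>
          (\<forall>i\<in>I \<union> K. (\<Sum>j\<in>UNIV. A $ i $ j * x j) = d * of_bool (i \<in> I))) \<or>
        (\<exists>\<phi>. range \<phi> \<subseteq> ?G \<and> (\<forall>j\<in>UNIV. (\<Sum>i\<in>I \<union> K. \<phi> i * A $ i $ j) = 0) \<and>
          (\<Sum>i\<in>I \<union> K. \<phi> i * of_bool (i \<in> I)) \<noteq> 0)"
    using A by (intro fredholm_alternative_subring)
      (auto intro: gaussian_integers_diff gaussian_integers_mult)
  then show ?thesis
  proof (elim disjE exE conjE)
    fix x d
    assume x: "range x \<subseteq> ?G" and d: "d \<in> ?G - {0}"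
      and eq: "\<forall>i\<in>I \<union> K. (\<Sum>j\<in>UNIV. A $ i $ j * x j) = d * of_bool (i \<in> I)"
    obtain n where n: "n > 0" "d * cnj d = of_nat n"
      using d gaussian_integers_mult_cnj by blast
    \<comment> \<open>The right-hand side found is a Gaussian \<open>d\<close>; the factor
      \<open>cnj d\<close> makes it the natural number \<open>n\<close>.\<close>
    define z :: "complex ^ 'v" where "z = (\<chi> j. cnj d * x j)"
    have "(A *v z) $ i = of_nat n * of_bool (i \<in> I)" if "i \<in> I \<union> K" for i
    proof -
      have "(A *v z) $ i = cnj d * (\<Sum>j\<in>UNIV. A $ i $ j * x j)"
        by (simp add: z_def matrix_vector_mult_def sum_distrib_left mult_ac)
      also have "\<dots> = d * cnj d * of_bool (i \<in> I)"
        using eq that by simp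
      finally show ?thesis
        using n by simp
    qed
    moreover have "z \<in> vectors_over ?G"
      using x d by (auto simp: z_def vectors_over_def intro!: gaussian_integers_mult gaussian_integers_cnj)
    ultimately have "solves_level A I K"
      unfolding solves_level_def using n disj by (intro bexI[of _ z] exI[of _ n]) auto
    then show ?thesis
      by blast
  next
    fix \<phi>
    assume \<phi>: "range \<phi> \<subseteq> ?G" and rel: "\<forall>j\<in>UNIV. (\<Sum>i\<in>I \<union> K. \<phi> i * A $ i $ j) = 0"
      and nz: "(\<Sum>i\<in>I \<union> K. \<phi> i * of_bool (i \<in> I)) \<noteq> 0"
    define s where "s = (\<Sum>i\<in>I. \<phi> i)"
    have s: "s \<in> ?G" "s \<noteq> 0"
      using \<phi> nz disj by (auto simp: s_def sum.union_disjoint intro!: gaussian_integers_sum)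
    then obtain n where n: "n > 0" "s * cnj s = of_nat n"
      using gaussian_integers_mult_cnj by blast
    have False if p: "prime p" "n < p" and r: "r \<in> gaussian_digits p - {0}" and q: "q \<noteq> 0"
      and onI: "\<forall>i\<in>I. \<exists>g\<in>?G. (A *v x) $ i = q * (r + of_nat p * g)"
      and onK: "\<forall>i\<in>K. \<exists>g\<in>?G. (A *v x) $ i = q * (of_nat p * g)" for p r q x
    proof -
      \<comment> \<open>Both row sets in one formula: on \<open>K\<close> the digit is 0.\<close>
      have "\<forall>i\<in>I \<union> K. \<exists>g. g \<in> ?G \<and> (A *v x) $ i = q * (of_bool (i \<in> I) * r + of_nat p * g)"
        using onI onK disj by fastforce
      then obtain g where g: "\<And>i. i \<in> I \<union> K \<Longrightarrow> g i \<in> ?G"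
        "\<And>i. i \<in> I \<union> K \<Longrightarrow> (A *v x) $ i = q * (of_bool (i \<in> I) * r + of_nat p * g i)"
        by metis
      define h where "h = (\<Sum>i\<in>I \<union> K. \<phi> i * g i)"
      have h: "h \<in> ?G"
        using \<phi> g by (auto simp: h_def intro!: gaussian_integers_sum gaussian_integers_mult)
      have "(\<Sum>i\<in>I \<union> K. \<phi> i * (A *v x) $ i)
          = (\<Sum>i\<in>I \<union> K. \<Sum>j\<in>UNIV. \<phi> i * A $ i $ j * x $ j)"
        by (simp add: matrix_vector_mult_def sum_distrib_left mult_ac)
      also have "\<dots> = (\<Sum>j\<in>UNIV. (\<Sum>i\<in>I \<union> K. \<phi> i * A $ i $ j) * x $ j)"
        by (subst sum.swap) (simp add: sum_distrib_right)
      also have "\<dots> = 0"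
        using rel by simp
      finally have "0 = (\<Sum>i\<in>I \<union> K. \<phi> i * (q * (of_bool (i \<in> I) * r + of_nat p * g i)))"
        using g by simp
      also have "\<dots> = (\<Sum>i\<in>I \<union> K. q * r * (\<phi> i * of_bool (i \<in> I)) + q * of_nat p * (\<phi> i * g i))"
        by (simp only: algebra_simps)
      also have "\<dots> = q * (r * (\<Sum>i\<in>I \<union> K. \<phi> i * of_bool (i \<in> I)) + of_nat p * h)"
        by (simp only: h_def sum.distrib sum_distrib_left[symmetric] distrib_left mult.assoc)
      also have "(\<Sum>i\<in>I \<union> K. \<phi> i * of_bool (i \<in> I)) = s"
        using disj by (auto simp: s_def sum.union_disjoint intro!: sum.neutral)
      finally have "r * s = of_nat p * (0 - h)"
        using q by (simp add: eq_neg_iff_add_eq_0)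
      \<comment> \<open>The factor \<open>cnj s\<close> makes the cofactor of \<open>r\<close> a
        natural number below \<open>p\<close>, so that divisibility can be read off
        coordinatewise.\<close>
      then have "r * of_nat n = of_nat p * ((0 - h) * cnj s)"
        by (metis mult.assoc n(2))
      moreover have "(0 - h) * cnj s \<in> ?G"
        using h s by (intro gaussian_integers_mult gaussian_integers_diff gaussian_integers_cnj) auto
      ultimately have "r = 0"
        using p r n by (intro prime_not_dvd_gaussian_digit_mult[of p n r]) auto
      then show False
        using r by simp
    qed
    then show ?thesis
      by blast
  qed
qed

text \<open>There are finitely many pairs of row sets, so one prime \<open>p\<close> exceeds all
  their thresholds. A monochromatic image has the same last nonzero digit \<open>r\<close> in every
  row. After division by \<open>p ^ n\<close>, the rows of level \<open>n\<close> are congruent to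
  \<open>r\<close> modulo \<open>p\<close> and those of higher level to 0.\<close>

lemma image_partition_regular_levels:
  fixes A :: "complex ^ 'v::finite ^ 'u::finite"
  assumes A: "\<forall>i j. A $ i $ j \<in> gaussian_integers" and "image_partition_regular A"
  obtains l :: "'u \<Rightarrow> nat" where "\<And>n. solves_level A {i. l i = n} {i. l i > n}"
proof -
  let ?G = gaussian_integers
  define large where "large N I K \<longleftrightarrow> (\<forall>p r q x. prime p \<longrightarrow> N < p \<longrightarrow> r \<in> gaussian_digits p - {0} \<longrightarrow> q \<noteq> 0 \<longrightarrow>
    (\<forall>i\<in>I. \<exists>g\<in>?G. (A *v x) $ i = q * (r + of_nat p * g)) \<longrightarrow>
    (\<forall>i\<in>K. \<exists>g\<in>?G. (A *v x) $ i = q * (of_nat p * g)) \<longrightarrow>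
    solves_level A I K)" for N I K
  have "\<exists>N. I \<inter> K = {} \<longrightarrow> large N I K" for I K :: "'u set"
    using solves_level_large_prime[OF A, of I K] unfolding large_def by blast
  then obtain N where N: "\<And>I K :: 'u set. I \<inter> K = {} \<Longrightarrow> large (N I K) I K"
    by metis
  obtain p where p: "prime p" "p > Max (range (\<lambda>(I, K). N I K))"
    using bigger_prime by blast
  have "N I K \<le> Max (range (\<lambda>(I, K). N I K))" for I K
    by (rule Max_ge) (auto intro: rev_image_eqI[of "(I, K)"])
  then have Np: "N I K < p" for I K
    using p(2) le_less_trans by blast
  have p2: "p \<ge> 2"
    using p(1) prime_ge_2_nat by blast
  have "\<forall>x \<in> ?G - {0}. \<exists>n r. r \<in> gaussian_digits p - {0} \<and> (\<exists>g \<in> ?G.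
      x = of_nat p ^ n * (r + of_nat p * g))"
    using gaussian_integers_last_digit[OF _ _ p2] by blast
  then obtain val dig where vd: "\<And>x. x \<in> ?G - {0} \<Longrightarrow> dig x \<in> gaussian_digits p - {0}"
    "\<And>x. x \<in> ?G - {0} \<Longrightarrow> \<exists>g \<in> ?G. x = of_nat p ^ val x * (dig x + of_nat p * g)"
    by metis
  have "finite (dig ` (?G - {0}))"
    by (rule finite_subset[of _ "gaussian_digits p"]) (use vd(1) in auto)
  then obtain x r where x: "\<And>i. (A *v x) $ i \<in> ?G - {0}" "\<And>i. dig ((A *v x) $ i) = r"
    using image_partition_regular_colouring[OF assms(2)] by metis
  define l where "l i = val ((A *v x) $ i)" for i
  have entry: "\<exists>g \<in> ?G. (A *v x) $ i = of_nat p ^ l i * (r + of_nat p * g)" for i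
    using vd(2)[OF x(1)[of i]] x(2) by (simp add: l_def)
  have r: "r \<in> gaussian_digits p - {0}"
    using vd(1)[OF x(1)] x(2) by metis
  have "solves_level A {i. l i = n} {i. l i > n}" for n
  proof -
    have "\<exists>g \<in> ?G. (A *v x) $ i = of_nat p ^ n * (of_nat p * g)" if "l i > n" for i
    proof -
      obtain g where g: "g \<in> ?G" "(A *v x) $ i = of_nat p ^ l i * (r + of_nat p * g)"
        using entry by blast
      \<comment> \<open>The summand 1 keeps one factor \<open>p\<close> after \<open>p ^ n\<close>
        is taken out.\<close>
      obtain m where m: "l i = n + 1 + m"
        using less_imp_Suc_add[OF \<open>l i > n\<close>] by auto
      have "(A *v x) $ i = of_nat p ^ n * (of_nat p * (of_nat (p ^ m) * (r + of_nat p * g)))"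
        using g(2) by (simp add: m power_add mult_ac)
      moreover have "of_nat (p ^ m) * (r + of_nat p * g) \<in> ?G"
        using r g(1) gaussian_digits_subset[of p]
        by (intro gaussian_integers_mult gaussian_integers_add gaussian_integers_of_nat) auto
      ultimately show ?thesis
        by blast
    qed
    moreover have "\<exists>g \<in> ?G. (A *v x) $ i = of_nat p ^ n * (r + of_nat p * g)" if "l i = n" for i
      using entry[of i] that by simp
    moreover have "large (N {i. l i = n} {i. l i > n}) {i. l i = n} {i. l i > n}"
      by (rule N) auto
    moreover have "(of_nat p :: complex) ^ n \<noteq> 0"
      using p2 by simp
    ultimately show ?thesis
      using p(1) Np r unfolding large_def by blast
  qed
  then show ?thesis
    by (rule that)
qed

section \<open>Absorption into a thick set\<close>

text \<open>The translation \<open>x\<close> supplied by thickness may have any residue modulo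
  \<open>d\<close>. Translating all \<open>e - r\<close> with digits \<open>r\<close> at once allows
  for each of them: if \<open>x = r + d * t\<close>, then
  \<open>e - r + x = e + d * t\<close>.\<close>

lemma thick_in_gaussian_integers_multiple:
  assumes C: "thick_in gaussian_integers C" and E: "finite E" "E \<subseteq> gaussian_integers"
    and d: "d > (0 :: nat)"
  shows "\<exists>t \<in> gaussian_integers. \<forall>e\<in>E. e + t * of_nat d \<in> C"
proof (cases "E = {}")
  case False
  let ?F = "(\<lambda>(e, r). e - r) ` (E \<times> gaussian_digits d)"
  have "finite ?F" "?F \<noteq> {}" "?F \<subseteq> gaussian_integers"
    using E False d gaussian_digits_subset[of d]
    by (auto simp: gaussian_digits_def intro!: gaussian_integers_diff)
  then obtain x where x: "x \<in> gaussian_integers" "(\<lambda>y. y + x) ` ?F \<subseteq> C"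
    using C unfolding thick_in_def by blast
  obtain r t where rt: "r \<in> gaussian_digits d" "t \<in> gaussian_integers" "x = r + of_nat d * t"
    using gaussian_integers_divmod[OF x(1) d] .
  have "e + t * of_nat d \<in> C" if "e \<in> E" for e
  proof -
    have "(e - r) + x \<in> C"
      using x(2) that rt(1) by force
    then show ?thesis
      by (simp add: rt(3) mult.commute)
  qed
  then show ?thesis
    using rt(2) by blast
qed (use gaussian_integers_0 in blast)

lemma matrix_vector_mult_gaussian_integers:
  fixes A :: "complex ^ 'v::finite ^ 'u::finite"
  assumes "\<forall>i j. A $ i $ j \<in> gaussian_integers" "x \<in> vectors_over gaussian_integers"
  shows "(A *v x) $ i \<in> gaussian_integers"
  using assms
  by (auto simp: matrix_vector_mult_def vectors_over_def intro!: gaussian_integers_sum gaussian_integers_mult)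

text \<open>A single \<open>z\<close> serves all of \<open>F\<close> because at each level the
  values for all \<open>f \<in> F\<close> form one finite set of offsets. The induction goes down
  from the top level.\<close>

lemma thick_in_absorbs_levels:
  fixes A :: "complex ^ 'v::finite ^ 'u::finite" and l :: "'u \<Rightarrow> nat"
  assumes A: "\<forall>i j. A $ i $ j \<in> gaussian_integers"
    and l: "\<And>n. solves_level A {i. l i = n} {i. l i > n}"
    and C: "thick_in gaussian_integers C"
    and F: "finite F" "F \<subseteq> vectors_over gaussian_integers"
  shows "\<exists>z \<in> vectors_over gaussian_integers. \<forall>f\<in>F. A *v (f + z) \<in> vectors_over C"
proof -
  let ?V = "vectors_over gaussian_integers"
  \<comment> \<open>One above the top level: there the claim is vacuous, and \<open>z = 0\<close>
    starts the induction.\<close>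
  let ?m = "Suc (Max (range l))"
  have below: "l i < ?m" for i
    by (simp add: less_Suc_eq_le)
  have "\<exists>z \<in> ?V. \<forall>f\<in>F. \<forall>i. n \<le> l i \<longrightarrow> (A *v (f + z)) $ i \<in> C" if "n \<le> ?m" for n
    using that
  proof (induction n rule: inc_induct)
    case base
    have "0 \<in> ?V"
      by (simp add: vectors_over_def)
    then show ?case
      using below by (metis not_le)
  next
    case (step n)
    then obtain z where z: "z \<in> ?V" "\<And>f i. f \<in> F \<Longrightarrow> Suc n \<le> l i \<Longrightarrow> (A *v (f + z)) $ i \<in> C"
      by blast
    obtain w d where w: "w \<in> ?V" and d: "d > (0 :: nat)"
      and wn: "\<And>i. l i = n \<Longrightarrow> (A *v w) $ i = of_nat d" "\<And>i. l i > n \<Longrightarrow> (A *v w) $ i = 0"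
      using l[of n] unfolding solves_level_def by auto
    \<comment> \<open>Computed from the current \<open>z\<close>, so the disturbance of level
      \<open>n\<close> by earlier steps is already included.\<close>
    define E where "E = (\<lambda>(f, i). (A *v (f + z)) $ i) ` (F \<times> UNIV)"
    have "finite E"
      using F by (simp add: E_def)
    moreover have "E \<subseteq> gaussian_integers"
      using F(2) z(1) matrix_vector_mult_gaussian_integers[OF A]
      by (auto simp: E_def intro: vectors_over_gaussian_integers_add)
    ultimately obtain t where t: "t \<in> gaussian_integers" "\<And>e. e \<in> E \<Longrightarrow> e + t * of_nat d \<in> C"
      using thick_in_gaussian_integers_multiple[OF C, of E d] d by blast
    have "(A *v (f + (z + t *s w))) $ i \<in> C" if "f \<in> F" "n \<le> l i" for f i
    proof -
      have "(A *v (f + (z + t *s w))) $ i = (A *v (f + z)) $ i + t * (A *v w) $ i"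
        by (simp add: matrix_vector_right_distrib vector_scalar_commute add.assoc)
      moreover have "(A *v (f + z)) $ i \<in> E"
        using that by (auto simp: E_def)
      ultimately show ?thesis
        using that wn z(2) t(2) by (cases "l i = n") auto
    qed
    moreover have "z + t *s w \<in> ?V"
      using z(1) w t(1)
      by (auto simp: vectors_over_def intro!: gaussian_integers_add gaussian_integers_mult)
    ultimately show ?case
      by blast
  qed
  from this[of 0] show ?thesis
    by (simp add: vectors_over_def)
qed

section \<open>Translation by constant vectors to reach nonzero entries\<close>

theorem theorem2p10:
  fixes A :: "complex ^ 'v::finite ^ 'u::finite" and C :: "complex set"
  assumes "\<forall>i j. A $ i $ j \<in> gaussian_integers"
    and "image_partition_regular A"
    and "thick_in gaussian_integers C"
  shows "thick_in (vectors_over gaussian_integers :: (complex ^ 'v) set)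
           {z \<in> vectors_over (gaussian_integers - {0}). A *v z \<in> vectors_over C}"
proof -
  let ?V = "vectors_over gaussian_integers :: (complex ^ 'v) set"
  let ?W = "{z \<in> vectors_over (gaussian_integers - {0}). A *v z \<in> vectors_over C}"
  obtain l :: "'u \<Rightarrow> nat" where l: "\<And>n. solves_level A {i. l i = n} {i. l i > n}"
    using image_partition_regular_levels[OF assms(1,2)] by blast
  have "\<exists>x\<in>?V. (\<lambda>y. y + x) ` F \<subseteq> ?W" if F: "finite F" "F \<subseteq> ?V" for F
  proof -
    \<comment> \<open>Each pair of a vector in \<open>F\<close> and a coordinate rules out at most
      one shift, so one of the \<open>N + 1\<close> shifts from 0 to \<open>N\<close>
      survives.\<close>
    define N where "N = card (F \<times> (UNIV :: 'v set))"
    define c :: "nat \<Rightarrow> complex ^ 'v" where "c n = (\<chi> j. of_nat n)" for n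
    have c: "c n \<in> ?V" for n
      by (simp add: c_def vectors_over_def)
    \<comment> \<open>The surviving shift depends on \<open>z\<close>, so \<open>z\<close> is found
      first and has to work for all shifts together.\<close>
    define F' where "F' = (\<lambda>(f, n). f + c n) ` (F \<times> {..N})"
    have "finite F'" "F' \<subseteq> ?V"
      using F c by (auto simp: F'_def intro!: vectors_over_gaussian_integers_add)
    then obtain z where z: "z \<in> ?V" "\<And>f. f \<in> F' \<Longrightarrow> A *v (f + z) \<in> vectors_over C"
      using thick_in_absorbs_levels[OF assms(1) l assms(3), of F'] by blast
    define bad where "bad = (\<lambda>(f, j). - (f $ j + z $ j)) ` (F \<times> (UNIV :: 'v set))"
    have "finite bad"
      using F(1) by (simp add: bad_def)
    have "card bad < card ((of_nat :: nat \<Rightarrow> complex) ` {..N})"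
      using F(1) card_image_le[of "F \<times> (UNIV :: 'v set)" "\<lambda>(f, j). - (f $ j + z $ j)"]
      by (simp add: bad_def N_def card_image inj_on_def less_Suc_eq_le)
    then have "\<not> of_nat ` {..N} \<subseteq> bad"
      using card_mono[OF \<open>finite bad\<close>, of "of_nat ` {..N}"] by linarith
    then obtain n where n: "n \<le> N" "of_nat n \<notin> bad"
      by auto
    have "f + (c n + z) \<in> ?W" if "f \<in> F" for f
    proof -
      have "f + c n \<in> F'"
        using that n(1) by (auto simp: F'_def)
      then have "A *v (f + (c n + z)) \<in> vectors_over C"
        using z(2)[of "f + c n"] by (simp add: add.assoc)
      moreover have "f + (c n + z) \<in> ?V"
        using that F c z(1) by (auto intro!: vectors_over_gaussian_integers_add)
      moreover have "(f + (c n + z)) $ j \<noteq> 0" for j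
      proof
        assume "(f + (c n + z)) $ j = 0"
        then have "of_nat n = - (f $ j + z $ j)"
          by (simp add: c_def eq_neg_iff_add_eq_0 algebra_simps)
        then show False
          using n(2) that by (auto simp: bad_def)
      qed
      ultimately show ?thesis
        by (simp add: vectors_over_def)
    qed
    then show ?thesis
      using c z(1) by (intro bexI[of _ "c n + z"]) (auto intro: vectors_over_gaussian_integers_add)
  qed
  moreover have "?W \<subseteq> ?V"
    by (auto simp: vectors_over_def)
  ultimately show ?thesis
    by (auto simp: thick_in_def)
qed

end
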